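(* Let $F:(M,g_M)\to(N,g_N)$ be a Riemannian map between Riemannian manifolds such that the distribution $(range F_\ast)^\bot$ is totally geodesic. Then for any $X\in\Gamma(TM)$ and $V,W\in\Gamma(range F_\ast)^\bot$, $$\begin{aligned}R^N(F_\ast X,V)W=&-\mathcal{S}_{\nabla_V^{F\bot}W}F_\ast X+\nabla_X^{F\bot}\nabla_V^{F\bot}W+\nabla_V^N\mathcal{S}_WF_\ast X-\nabla_V^{F\bot}\nabla_X^{F\bot}W-\mathcal{S}_W\mathcal{S}_VF_\ast X\\&+\nabla^{F\bot}_{{}^\ast F_\ast(\mathcal{S}_VF_\ast X)}W-\nabla^{F\bot}_{\nabla_X^{F\bot}V}W-\mathcal{S}_W\nabla_V^NF_\ast X+\nabla^{F\bot}_{{}^\ast F_\ast(\nabla_V^NF_\ast X)}W,\end{aligned}$$ and the component $R^{F\bot}(F_\ast X,V)W$ of $R^N(F_\ast X,V)W$ on $(range F_\ast)^\bot$ is $$R^{F\bot}(F_\ast X,V)W=\nabla_X^{F\bot}\nabla_V^{F\bot}W-\nabla_V^{F\bot}\nabla_X^{F\bot}W-\nabla^{F\bot}_{\nabla_X^{F\bot}V}W+\nabla^{F\bot}_{{}^\ast F_\ast(\mathcal{S}_VF_\ast X)}W+\nabla^{F\bot}_{{}^\ast F_\ast(\nabla_V^NF_\ast X)}W.$$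
   Context: A smooth map $F:(M^m,g_M)\to(N^n,g_N)$ with $0<rank F\le\min\{m,n\}$ is a Riemannian map if at each $p\in M$ the restriction of $F_{\ast p}$ to $(\ker F_{\ast p})^\bot$ is a linear isometry onto $range F_{\ast p}$. $(range F_\ast)^\bot$ is the orthogonal complement of $range F_\ast$ in $TN$; following the paper, $range F_\ast$ and $(range F_\ast)^\bot$ are regarded as complementary orthogonal distributions (subbundles of $TN$) on $N$. $\nabla^N$ is the Levi-Civita connection of $N$ and $R^N(X_1,Y_1)Z_1=\nabla^N_{X_1}\nabla^N_{Y_1}Z_1-\nabla^N_{Y_1}\nabla^N_{X_1}Z_1-\nabla^N_{[X_1,Y_1]}Z_1$. ${}^\ast F_\ast$ is the adjoint of $F_\ast$. For $X\in\Gamma(TM)$ and $V\in\Gamma(range F_\ast)^\bot$, $\mathcal{S}_VF_\ast X\in\Gamma(range F_\ast)$ and $\nabla_X^{F\bot}V\in\Gamma(range F_\ast)^\bot$ are defined by the orthogonal decomposition $\nabla^N_{F_\ast X}V=-\mathcal{S}_VF_\ast X+\nabla^{F\bot}_XV$. For $U,V\in\Gamma(range F_\ast)^\bot$, $\nabla_U^{F\bot}V$ is the component of $\nabla^N_UV$ in $(range F_\ast)^\bot$. The distribution $(range F_\ast)^\bot$ is totally geodesic if $\nabla^N_UV=\nabla^{F\bot}_UV$ for all $U,V\in\Gamma(range F_\ast)^\bot$. *)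

theory Defs
  imports "HOL-Analysis.Analysis" "HOL-Library.Function_Algebras"
begin

text \<open>Pointwise scaling, so that functionals and vector fields live in a real vector space and
  \<open>span\<close>, \<open>independent\<close>, \<open>dim\<close> apply to tangent spaces.\<close>

instantiation "fun" :: (type, real_vector) real_vector
begin
definition scaleR_fun :: "real \<Rightarrow> ('a \<Rightarrow> 'b) \<Rightarrow> 'a \<Rightarrow> 'b"
  where "scaleR_fun c f = (\<lambda>x. c *\<^sub>R f x)"
instance
  by standard (simp_all add: scaleR_fun_def fun_eq_iff scaleR_add_right scaleR_add_left)
end


section \<open>Smooth manifolds\<close>

text \<open>Continuous differentiability of order \<open>k\<close> on an open subset \<open>S\<close> of a finite-dimensional space.\<close>

primrec Ck_on :: "nat \<Rightarrow> 'e::euclidean_space set \<Rightarrow> ('e \<Rightarrow> 'f::real_normed_vector) \<Rightarrow> bool" where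
  "Ck_on 0 S f \<longleftrightarrow> continuous_on S f"
| "Ck_on (Suc k) S f \<longleftrightarrow>
     f differentiable_on S \<and> (\<forall>v. Ck_on k S (\<lambda>x. frechet_derivative f (at x) v))"

definition Cinf_on :: "'e::euclidean_space set \<Rightarrow> ('e \<Rightarrow> 'f::real_normed_vector) \<Rightarrow> bool"
  where "Cinf_on S f \<longleftrightarrow> (\<forall>k. Ck_on k S f)"

text \<open>A manifold is a (Hausdorff, second countable) topological type with a smooth atlas; a chart is
  given by its domain and its coordinate map. The dimension is \<open>DIM('e)\<close>.\<close>

type_synonym ('a, 'e) chart = "'a set \<times> ('a \<Rightarrow> 'e)"

definition smooth_atlas ::
    "('a::{t2_space,second_countable_topology}, 'e::euclidean_space) chart set \<Rightarrow> bool" where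
  "smooth_atlas A \<longleftrightarrow>
     (\<Union>(U, \<phi>)\<in>A. U) = UNIV \<and>
     (\<forall>(U, \<phi>)\<in>A. open U \<and> open (\<phi> ` U) \<and> homeomorphism U (\<phi> ` U) \<phi> (inv_into U \<phi>)) \<and>
     (\<forall>(U, \<phi>)\<in>A. \<forall>(U', \<phi>')\<in>A. Cinf_on (\<phi> ` (U \<inter> U')) (\<phi>' \<circ> inv_into U \<phi>))"

definition smooth_fun_on ::
    "('a::topological_space, 'e::euclidean_space) chart set \<Rightarrow> 'a set \<Rightarrow> ('a \<Rightarrow> real) \<Rightarrow> bool" where
  "smooth_fun_on A S f \<longleftrightarrow> (\<forall>(U, \<phi>)\<in>A. Cinf_on (\<phi> ` (S \<inter> U)) (f \<circ> inv_into U \<phi>))"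

abbreviation smooth_fun where "smooth_fun A \<equiv> smooth_fun_on A UNIV"

definition smooth_map ::
    "('a::topological_space, 'e::euclidean_space) chart set \<Rightarrow>
     ('b::topological_space, 'f::euclidean_space) chart set \<Rightarrow> ('a \<Rightarrow> 'b) \<Rightarrow> bool" where
  "smooth_map A B F \<longleftrightarrow> continuous_on UNIV F \<and>
     (\<forall>(U, \<phi>)\<in>A. \<forall>(O', \<psi>)\<in>B. Cinf_on (\<phi> ` (U \<inter> F -` O')) (\<psi> \<circ> F \<circ> inv_into U \<phi>))"


section \<open>Tangent vectors and vector fields\<close>

text \<open>Tangent vectors are derivations of the algebra of smooth functions. As HOL functions are total,
  they are normalised to vanish on non-smooth arguments, so that equal derivations are equal terms.\<close>

type_synonym 'a tangent = "('a \<Rightarrow> real) \<Rightarrow> real"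
type_synonym 'a vfield = "'a \<Rightarrow> 'a tangent"

definition tangent_space ::
    "('a::topological_space, 'e::euclidean_space) chart set \<Rightarrow> 'a \<Rightarrow> 'a tangent set" where
  "tangent_space A p = {v.
     (\<forall>f h. smooth_fun A f \<longrightarrow> smooth_fun A h \<longrightarrow> v (\<lambda>x. f x + h x) = v f + v h) \<and>
     (\<forall>f c. smooth_fun A f \<longrightarrow> v (\<lambda>x. c * f x) = c * v f) \<and>
     (\<forall>f h. smooth_fun A f \<longrightarrow> smooth_fun A h \<longrightarrow> v (\<lambda>x. f x * h x) = f p * v h + h p * v f) \<and>
     (\<forall>f. \<not> smooth_fun A f \<longrightarrow> v f = 0)}"

definition smooth_vfield_on ::
    "('a::topological_space, 'e::euclidean_space) chart set \<Rightarrow> 'a set \<Rightarrow> 'a vfield \<Rightarrow> bool" where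
  "smooth_vfield_on A S X \<longleftrightarrow> (\<forall>x\<in>S. X x \<in> tangent_space A x) \<and>
     (\<forall>f. smooth_fun A f \<longrightarrow> smooth_fun_on A S (\<lambda>x. X x f))"

abbreviation smooth_vfield where "smooth_vfield A \<equiv> smooth_vfield_on A UNIV"

definition lie_bracket ::
    "('a::topological_space, 'e::euclidean_space) chart set \<Rightarrow> 'a vfield \<Rightarrow> 'a vfield \<Rightarrow> 'a vfield" where
  "lie_bracket A X Y = (\<lambda>x f. if smooth_fun A f
     then X x (\<lambda>y. Y y f) - Y x (\<lambda>y. X y f) else 0)"

definition pushforward ::
    "('b::topological_space, 'f::euclidean_space) chart set \<Rightarrow> ('a \<Rightarrow> 'b) \<Rightarrow> 'a tangent \<Rightarrow> 'b tangent" where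
  "pushforward B F v = (\<lambda>h. if smooth_fun B h then v (h \<circ> F) else 0)"


section \<open>Riemannian metrics, connections, curvature\<close>

definition riemannian_metric ::
    "('a::topological_space, 'e::euclidean_space) chart set \<Rightarrow>
     ('a \<Rightarrow> 'a tangent \<Rightarrow> 'a tangent \<Rightarrow> real) \<Rightarrow> bool" where
  "riemannian_metric A g \<longleftrightarrow>
     (\<forall>x. \<forall>u\<in>tangent_space A x. \<forall>v\<in>tangent_space A x.
        g x u v = g x v u \<and> (u \<noteq> 0 \<longrightarrow> g x u u > 0) \<and>
        (\<forall>w\<in>tangent_space A x. \<forall>a b. g x (a *\<^sub>R u + b *\<^sub>R v) w = a * g x u w + b * g x v w)) \<and>
     (\<forall>S X Y. open S \<longrightarrow> smooth_vfield_on A S X \<longrightarrow> smooth_vfield_on A S Y \<longrightarrow>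
        smooth_fun_on A S (\<lambda>x. g x (X x) (Y x)))"

definition riemannian_manifold ::
    "('a::{t2_space,second_countable_topology}, 'e::euclidean_space) chart set \<Rightarrow>
     ('a \<Rightarrow> 'a tangent \<Rightarrow> 'a tangent \<Rightarrow> real) \<Rightarrow> bool" where
  "riemannian_manifold A g \<longleftrightarrow> smooth_atlas A \<and> riemannian_metric A g"

text \<open>\<open>nabla x v W\<close> is the covariant derivative of the vector field \<open>W\<close> in the direction of the
  tangent vector \<open>v\<close> at \<open>x\<close>; \<open>cov nabla Y W\<close> is the vector field usually written \<open>\<nabla>\<^bsub>Y\<^esub> W\<close>.\<close>

type_synonym 'a connection = "'a \<Rightarrow> 'a tangent \<Rightarrow> 'a vfield \<Rightarrow> 'a tangent"

definition cov :: "'a connection \<Rightarrow> 'a vfield \<Rightarrow> 'a vfield \<Rightarrow> 'a vfield"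
  where "cov nabla Y W = (\<lambda>x. nabla x (Y x) W)"

definition affine_connection ::
    "('a::topological_space, 'e::euclidean_space) chart set \<Rightarrow> 'a connection \<Rightarrow> bool" where
  "affine_connection A nabla \<longleftrightarrow>
     (\<forall>x. \<forall>v\<in>tangent_space A x. \<forall>W. smooth_vfield A W \<longrightarrow> nabla x v W \<in> tangent_space A x) \<and>
     (\<forall>x. \<forall>u\<in>tangent_space A x. \<forall>v\<in>tangent_space A x. \<forall>a b W. smooth_vfield A W \<longrightarrow>
        nabla x (a *\<^sub>R u + b *\<^sub>R v) W = a *\<^sub>R nabla x u W + b *\<^sub>R nabla x v W) \<and>
     (\<forall>x. \<forall>v\<in>tangent_space A x. \<forall>W Z. smooth_vfield A W \<longrightarrow> smooth_vfield A Z \<longrightarrow>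
        nabla x v (\<lambda>y. W y + Z y) = nabla x v W + nabla x v Z) \<and>
     (\<forall>x. \<forall>v\<in>tangent_space A x. \<forall>f W. smooth_fun A f \<longrightarrow> smooth_vfield A W \<longrightarrow>
        nabla x v (\<lambda>y. f y *\<^sub>R W y) = v f *\<^sub>R W x + f x *\<^sub>R nabla x v W) \<and>
     (\<forall>Y W. smooth_vfield A Y \<longrightarrow> smooth_vfield A W \<longrightarrow> smooth_vfield A (cov nabla Y W))"

definition levi_civita ::
    "('a::topological_space, 'e::euclidean_space) chart set \<Rightarrow>
     ('a \<Rightarrow> 'a tangent \<Rightarrow> 'a tangent \<Rightarrow> real) \<Rightarrow> 'a connection \<Rightarrow> bool" where
  "levi_civita A g nabla \<longleftrightarrow> affine_connection A nabla \<and>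
     (\<forall>X Y. smooth_vfield A X \<longrightarrow> smooth_vfield A Y \<longrightarrow>
        (\<forall>x. cov nabla X Y x - cov nabla Y X x = lie_bracket A X Y x)) \<and>
     (\<forall>X Y Z. smooth_vfield A X \<longrightarrow> smooth_vfield A Y \<longrightarrow> smooth_vfield A Z \<longrightarrow>
        (\<forall>x. Z x (\<lambda>y. g y (X y) (Y y)) = g x (cov nabla Z X x) (Y x) + g x (X x) (cov nabla Z Y x)))"

definition curvature ::
    "('a::topological_space, 'e::euclidean_space) chart set \<Rightarrow> 'a connection \<Rightarrow>
     'a vfield \<Rightarrow> 'a vfield \<Rightarrow> 'a vfield \<Rightarrow> 'a vfield" where
  "curvature A nabla X Y Z = (\<lambda>x. cov nabla X (cov nabla Y Z) x - cov nabla Y (cov nabla X Z) x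
     - cov nabla (lie_bracket A X Y) Z x)"


section \<open>Distributions\<close>

text \<open>A smooth subbundle of the tangent bundle, given by local frames (the rank \<open>k\<close> is locally
  constant).\<close>

definition smooth_distribution ::
    "('a::topological_space, 'e::euclidean_space) chart set \<Rightarrow> ('a \<Rightarrow> 'a tangent set) \<Rightarrow> bool" where
  "smooth_distribution A D \<longleftrightarrow> (\<forall>x. \<exists>S k E. open S \<and> x \<in> S \<and>
     (\<forall>i<k. smooth_vfield_on A S (E i)) \<and>
     (\<forall>y\<in>S. inj_on (\<lambda>i. E i y) {..<k::nat} \<and> independent ((\<lambda>i. E i y) ` {..<k}) \<and>
            D y = span ((\<lambda>i. E i y) ` {..<k})))"

definition sections ::
    "('a::topological_space, 'e::euclidean_space) chart set \<Rightarrow> ('a \<Rightarrow> 'a tangent set) \<Rightarrow> 'a vfield set" where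
  "sections A D = {X. smooth_vfield A X \<and> (\<forall>x. X x \<in> D x)}"

definition orth ::
    "('a::topological_space, 'e::euclidean_space) chart set \<Rightarrow>
     ('a \<Rightarrow> 'a tangent \<Rightarrow> 'a tangent \<Rightarrow> real) \<Rightarrow> ('a \<Rightarrow> 'a tangent set) \<Rightarrow> 'a \<Rightarrow> 'a tangent set" where
  "orth A g D = (\<lambda>x. {v \<in> tangent_space A x. \<forall>u\<in>D x. g x u v = 0})"

text \<open>The components of a tangent vector in \<open>D\<close> and in its orthogonal complement.\<close>

definition tan_part ::
    "('a::topological_space, 'e::euclidean_space) chart set \<Rightarrow>
     ('a \<Rightarrow> 'a tangent \<Rightarrow> 'a tangent \<Rightarrow> real) \<Rightarrow> ('a \<Rightarrow> 'a tangent set) \<Rightarrow>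
     'a \<Rightarrow> 'a tangent \<Rightarrow> 'a tangent" where
  "tan_part A g D x w = (THE u. u \<in> D x \<and> w - u \<in> orth A g D x)"

definition nor_part ::
    "('a::topological_space, 'e::euclidean_space) chart set \<Rightarrow>
     ('a \<Rightarrow> 'a tangent \<Rightarrow> 'a tangent \<Rightarrow> real) \<Rightarrow> ('a \<Rightarrow> 'a tangent set) \<Rightarrow>
     'a \<Rightarrow> 'a tangent \<Rightarrow> 'a tangent" where
  "nor_part A g D x w = (THE u. u \<in> orth A g D x \<and> w - u \<in> D x)"


section \<open>Riemannian maps\<close>

definition range_at ::
    "('a::topological_space, 'e::euclidean_space) chart set \<Rightarrow>
     ('b::topological_space, 'f::euclidean_space) chart set \<Rightarrow> ('a \<Rightarrow> 'b) \<Rightarrow> 'a \<Rightarrow> 'b tangent set" where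
  "range_at A B F p = pushforward B F ` tangent_space A p"

definition horizontal_space ::
    "('a::topological_space, 'e::euclidean_space) chart set \<Rightarrow>
     ('a \<Rightarrow> 'a tangent \<Rightarrow> 'a tangent \<Rightarrow> real) \<Rightarrow>
     ('b::topological_space, 'f::euclidean_space) chart set \<Rightarrow> ('a \<Rightarrow> 'b) \<Rightarrow> 'a \<Rightarrow> 'a tangent set" where
  "horizontal_space A gM B F =
     orth A gM (\<lambda>p. {v \<in> tangent_space A p. pushforward B F v = 0})"

definition riemannian_map ::
    "('a::topological_space, 'e::euclidean_space) chart set \<Rightarrow>
     ('a \<Rightarrow> 'a tangent \<Rightarrow> 'a tangent \<Rightarrow> real) \<Rightarrow>
     ('b::topological_space, 'f::euclidean_space) chart set \<Rightarrow>
     ('b \<Rightarrow> 'b tangent \<Rightarrow> 'b tangent \<Rightarrow> real) \<Rightarrow> ('a \<Rightarrow> 'b) \<Rightarrow> bool" where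
  "riemannian_map A gM B gN F \<longleftrightarrow> smooth_map A B F \<and>
     (\<forall>p. 0 < dim (range_at A B F p) \<and> dim (range_at A B F p) \<le> min DIM('e) DIM('f)) \<and>
     (\<forall>p. pushforward B F ` horizontal_space A gM B F p = range_at A B F p \<and>
        (\<forall>u\<in>horizontal_space A gM B F p. \<forall>v\<in>horizontal_space A gM B F p.
           gN (F p) (pushforward B F u) (pushforward B F v) = gM p u v))"

definition adjoint_push ::
    "('a::topological_space, 'e::euclidean_space) chart set \<Rightarrow>
     ('a \<Rightarrow> 'a tangent \<Rightarrow> 'a tangent \<Rightarrow> real) \<Rightarrow>
     ('b::topological_space, 'f::euclidean_space) chart set \<Rightarrow>
     ('b \<Rightarrow> 'b tangent \<Rightarrow> 'b tangent \<Rightarrow> real) \<Rightarrow> ('a \<Rightarrow> 'b) \<Rightarrow> 'a \<Rightarrow> 'b tangent \<Rightarrow> 'a tangent" where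
  "adjoint_push A gM B gN F p w = (THE u. u \<in> tangent_space A p \<and>
     (\<forall>v\<in>tangent_space A p. gM p u v = gN (F p) w (pushforward B F v)))"

text \<open>\<open>range F\<^sub>*\<close> as a distribution on all of \<open>N\<close>: a smooth subbundle \<open>D\<close> of \<open>TN\<close> whose fibre over every
  point \<open>F p\<close> of the image is the range of the differential at \<open>p\<close>. For surjective \<open>F\<close> this determines
  \<open>D\<close>; otherwise \<open>D\<close> is an extension off the image, without which derivatives of sections of
  \<open>range F\<^sub>*\<close> in directions transversal to the image would make no sense.\<close>

definition range_distribution ::
    "('a::topological_space, 'e::euclidean_space) chart set \<Rightarrow>
     ('b::topological_space, 'f::euclidean_space) chart set \<Rightarrow> ('a \<Rightarrow> 'b) \<Rightarrow>
     ('b \<Rightarrow> 'b tangent set) \<Rightarrow> bool" where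
  "range_distribution A B F D \<longleftrightarrow> smooth_distribution B D \<and> (\<forall>p. D (F p) = range_at A B F p)"

text \<open>In the next definitions \<open>D\<close> stands for \<open>range F\<^sub>*\<close>. The field \<open>shape B g D nabla V Y\<close> is
  \<open>\<S>\<^bsub>V\<^esub> Y\<close> for a section \<open>Y\<close> of \<open>D\<close>, and \<open>nor_cov B g D nabla Y V\<close> is the normal component of
  \<open>\<nabla>\<^bsub>Y\<^esub> V\<close>. For a vector field \<open>X\<close> on the domain, \<open>nor_cov_along\<close> gives \<open>\<nabla>\<^bsup>F\<bottom>\<^esup>\<^bsub>X\<^esub> V\<close> as a section
  along \<open>F\<close>; it is \<open>nor_cov B g D nabla Y V\<close> at \<open>F p\<close> whenever \<open>Y (F p) = F\<^sub>* (X p)\<close>.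

  \<open>F\<^sub>* X\<close> is a priori only a section along \<open>F\<close>, but terms such as \<open>\<nabla>\<^bsub>V\<^esub> F\<^sub>* X\<close> differentiate it as a
  section of \<open>range F\<^sub>*\<close> on \<open>N\<close>. At a point \<open>p\<close> it is therefore represented by any section \<open>FX\<close> of \<open>D\<close>
  with \<open>FX (F p) = F\<^sub>* (X p)\<close>; this puts no projectability condition on \<open>X\<close>, and when \<open>X\<close> is
  projectable the same \<open>FX\<close> serves for all \<open>p\<close>.\<close>

definition shape ::
    "('b::topological_space, 'f::euclidean_space) chart set \<Rightarrow>
     ('b \<Rightarrow> 'b tangent \<Rightarrow> 'b tangent \<Rightarrow> real) \<Rightarrow> ('b \<Rightarrow> 'b tangent set) \<Rightarrow> 'b connection \<Rightarrow>
     'b vfield \<Rightarrow> 'b vfield \<Rightarrow> 'b vfield" where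
  "shape B g D nabla V Y = (\<lambda>y. - tan_part B g D y (cov nabla Y V y))"

definition nor_cov ::
    "('b::topological_space, 'f::euclidean_space) chart set \<Rightarrow>
     ('b \<Rightarrow> 'b tangent \<Rightarrow> 'b tangent \<Rightarrow> real) \<Rightarrow> ('b \<Rightarrow> 'b tangent set) \<Rightarrow> 'b connection \<Rightarrow>
     'b vfield \<Rightarrow> 'b vfield \<Rightarrow> 'b vfield" where
  "nor_cov B g D nabla Y V = (\<lambda>y. nor_part B g D y (cov nabla Y V y))"

definition nor_cov_along ::
    "('b::topological_space, 'f::euclidean_space) chart set \<Rightarrow>
     ('b \<Rightarrow> 'b tangent \<Rightarrow> 'b tangent \<Rightarrow> real) \<Rightarrow> ('b \<Rightarrow> 'b tangent set) \<Rightarrow> 'b connection \<Rightarrow>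
     ('a \<Rightarrow> 'b) \<Rightarrow> 'a vfield \<Rightarrow> 'b vfield \<Rightarrow> 'a \<Rightarrow> 'b tangent" where
  "nor_cov_along B g D nabla F X V =
     (\<lambda>p. nor_part B g D (F p) (nabla (F p) (pushforward B F (X p)) V))"

definition orth_totally_geodesic ::
    "('b::topological_space, 'f::euclidean_space) chart set \<Rightarrow>
     ('b \<Rightarrow> 'b tangent \<Rightarrow> 'b tangent \<Rightarrow> real) \<Rightarrow> ('b \<Rightarrow> 'b tangent set) \<Rightarrow> 'b connection \<Rightarrow> bool" where
  "orth_totally_geodesic B g D nabla \<longleftrightarrow>
     (\<forall>U\<in>sections B (orth B g D). \<forall>V\<in>sections B (orth B g D). \<forall>y.
        cov nabla U V y = nor_cov B g D nabla U V y)"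

end

(* Expand the three terms of R(F_* X, V) W and split every covariant derivative of a normal field
   along range F_* and its complement. Total geodesy makes nabla_V U normal for normal U, and, by
   metric compatibility, nabla_V Y tangent to range F_* for Y in range F_*; F_* is a left inverse
   of its adjoint on range F_*. What is left is that the projections preserve smoothness, which is
   needed to differentiate nabla_V of a sum of components. *)

theory Submission
  imports Defs
begin

section \<open>Smooth functions\<close>

text \<open>The axioms for \<open>nabla\<close> speak only of globally smooth fields, whereas a
  subbundle is given by local frames, so frame fields themselves cannot be differentiated by
  \<open>nabla\<close>. Every field that is differentiated is therefore a component of a global
  field. Projections are built near each point from a frame, and by uniqueness of the orthogonal
  decomposition they agree with \<open>tan_part\<close> and \<open>nor_part\<close>, which are thus
  smooth everywhere. The same construction supplies the existence behind these definite
  descriptions. It divides by squared lengths instead of normalising, so the calculus of smooth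
  functions stops at sums, products and inverses. The curvature identity is proved on the target
  alone, for any distribution with totally geodesic complement. The map enters only at the end and
  only through values at \<open>F p\<close>, because \<open>nabla\<close> depends on its direction
  pointwise.\<close>

lemma Ck_on_subset:
  assumes "Ck_on k S f" "T \<subseteq> S"
  shows "Ck_on k T f"
  using assms
  by (induction k arbitrary: f) (auto intro: continuous_on_subset differentiable_on_subset)

lemma Ck_on_Suc_imp:
  assumes "Ck_on (Suc k) S f"
  shows "Ck_on k S f"
  using assms
  by (induction k arbitrary: f) (auto intro: differentiable_imp_continuous_on)

text \<open>Openness matters: \<open>Ck_on\<close> takes derivatives \<open>at x\<close>, not within
  \<open>S\<close>, so the two functions must agree on a full neighbourhood of each point for their
  derivatives to coincide.\<close>

lemma Ck_on_cong:
  assumes "open S" "Ck_on k S f" "\<And>x. x \<in> S \<Longrightarrow> f x = h x"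
  shows "Ck_on k S h"
  using assms(2,3)
proof (induction k arbitrary: f h)
  case 0
  then show ?case
    using continuous_on_eq by auto
next
  case (Suc k)
  have "h differentiable_on S"
    using Suc.prems has_derivative_transform
    unfolding differentiable_on_def differentiable_def by (metis Ck_on.simps(2) differentiable_on_def differentiable_def)
  moreover have "Ck_on k S (\<lambda>x. frechet_derivative h (at x) v)" for v
  proof (rule Suc.IH)
    show "Ck_on k S (\<lambda>x. frechet_derivative f (at x) v)"
      using Suc.prems by simp
  next
    fix x assume x: "x \<in> S"
    then have "f differentiable (at x)"
      using Suc.prems(1) \<open>open S\<close> by (simp add: differentiable_on_eq_differentiable_at)
    then have "(h has_derivative frechet_derivative f (at x)) (at x)"
      using has_derivative_transform_within_open[OF _ \<open>open S\<close> x] Suc.prems(2)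
        frechet_derivative_works by blast
    then show "frechet_derivative f (at x) v = frechet_derivative h (at x) v"
      using frechet_derivative_at by metis
  qed
  ultimately show ?case by simp
qed

text \<open>Continuity and differentiability are checked point by point, and
  \<open>frechet_derivative f (at x)\<close> does not mention the set, so the induction hypothesis
  applies to it unchanged. This is what later glues local projections.\<close>

lemma Ck_on_locally:
  assumes "\<And>x. x \<in> S \<Longrightarrow> \<exists>T. open T \<and> x \<in> T \<and> Ck_on k T f"
  shows "Ck_on k S f"
  using assms
proof (induction k arbitrary: f)
  case 0
  have "continuous (at x) f" if x: "x \<in> S" for x
  proof -
    obtain T where "open T" "x \<in> T" "Ck_on 0 T f"
      using 0 x by blast
    then show ?thesis
      by (auto simp: continuous_on_eq_continuous_at)
  qed
  then show ?case
    by (simp add: continuous_at_imp_continuous_on)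
next
  case (Suc k)
  have "f differentiable (at x)" if x: "x \<in> S" for x
  proof -
    obtain T where "open T" "x \<in> T" "Ck_on (Suc k) T f"
      using Suc.prems x by blast
    then show ?thesis
      by (auto simp: differentiable_on_eq_differentiable_at)
  qed
  then have "f differentiable_on S"
    by (simp add: differentiable_at_imp_differentiable_on)
  moreover have "Ck_on k S (\<lambda>x. frechet_derivative f (at x) v)" for v
    by (rule Suc.IH) (use Suc.prems in fastforce)
  ultimately show ?case by simp
qed

text \<open>Replaces the chosen \<open>frechet_derivative\<close> by an explicit formula
  \<open>f'\<close>, so that the differentiation rules can drive the inductions on the
  order.\<close>

lemma Ck_on_SucI:
  assumes "open S" "\<And>x. x \<in> S \<Longrightarrow> (f has_derivative f' x) (at x)"
    and "\<And>v. Ck_on k S (\<lambda>x. f' x v)"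
  shows "Ck_on (Suc k) S f"
proof -
  have "f differentiable_on S"
    using assms(2) by (meson differentiable_at_imp_differentiable_on differentiable_def)
  moreover have "Ck_on k S (\<lambda>x. frechet_derivative f (at x) v)" for v
  proof (rule Ck_on_cong[OF assms(1,3)])
    show "f' x v = frechet_derivative f (at x) v" if "x \<in> S" for x
      using frechet_derivative_at[OF assms(2)[OF that]] by simp
  qed
  ultimately show ?thesis by simp
qed

lemma Ck_on_Suc_has_derivative:
  assumes "open S" "Ck_on (Suc k) S f" "x \<in> S"
  shows "(f has_derivative frechet_derivative f (at x)) (at x)"
  using assms by (simp add: differentiable_on_eq_differentiable_at flip: frechet_derivative_works)

lemma Ck_on_add:
  assumes "open S" "Ck_on k S f" "Ck_on k S h"
  shows "Ck_on k S (\<lambda>x. f x + h x)"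
  using assms(2,3)
proof (induction k arbitrary: f h)
  case 0
  then show ?case by (auto intro: continuous_intros)
next
  case (Suc k)
  show ?case
    by (rule Ck_on_SucI[OF \<open>open S\<close>
          has_derivative_add[OF Ck_on_Suc_has_derivative[OF \<open>open S\<close> Suc.prems(1)]
            Ck_on_Suc_has_derivative[OF \<open>open S\<close> Suc.prems(2)]]])
      (use Suc in auto)
qed

lemma Ck_on_mult:
  fixes f h :: "'e::euclidean_space \<Rightarrow> real"
  assumes "open S" "Ck_on k S f" "Ck_on k S h"
  shows "Ck_on k S (\<lambda>x. f x * h x)"
  using assms(2,3)
proof (induction k arbitrary: f h)
  case 0
  then show ?case by (auto intro: continuous_intros)
next
  case (Suc k)
  show ?case
  proof (rule Ck_on_SucI[OF \<open>open S\<close>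
          has_derivative_mult[OF Ck_on_Suc_has_derivative[OF \<open>open S\<close> Suc.prems(1)]
            Ck_on_Suc_has_derivative[OF \<open>open S\<close> Suc.prems(2)]]])
    show "Ck_on k S (\<lambda>x. f x * frechet_derivative h (at x) v + frechet_derivative f (at x) v * h x)"
      for v
      \<comment> \<open>The Leibniz formula also contains the undifferentiated factors, which must
        be lowered from order \<open>Suc k\<close> to \<open>k\<close>.\<close>
      using Suc.prems Ck_on_Suc_imp[OF Suc.prems(1)] Ck_on_Suc_imp[OF Suc.prems(2)]
      by (intro Ck_on_add[OF \<open>open S\<close>] Suc.IH) auto
  qed
qed

lemma Ck_on_const: "Ck_on k S (\<lambda>x. c)"
  by (induction k arbitrary: c) (auto simp: frechet_derivative_const)

text \<open>The derivative of \<open>1/f\<close> is a product of \<open>1/f\<close> twice and a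
  derivative of \<open>f\<close>, so order \<open>k\<close> for \<open>1/f\<close> yields order
  \<open>Suc k\<close>.\<close>

lemma Ck_on_inverse:
  fixes f :: "'e::euclidean_space \<Rightarrow> real"
  assumes "open S" "Ck_on k S f" "\<And>x. x \<in> S \<Longrightarrow> f x \<noteq> 0"
  shows "Ck_on k S (\<lambda>x. inverse (f x))"
  using assms(2)
proof (induction k)
  case 0
  with assms(3) show ?case by (auto intro: continuous_intros)
next
  case (Suc k)
  have inv: "Ck_on k S (\<lambda>x. inverse (f x))"
    by (rule Suc.IH[OF Ck_on_Suc_imp[OF Suc.prems]])
  show ?case
  proof (rule Ck_on_SucI[OF \<open>open S\<close>
          Deriv.has_derivative_inverse[OF assms(3) Ck_on_Suc_has_derivative[OF \<open>open S\<close> Suc.prems]]])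
    have "Ck_on k S (\<lambda>x. (-1) * (inverse (f x) * frechet_derivative f (at x) v * inverse (f x)))"
      for v
      using Suc.prems
      by (intro Ck_on_mult[OF \<open>open S\<close>] inv Ck_on_const) simp
    then show "Ck_on k S (\<lambda>x. - (inverse (f x) * frechet_derivative f (at x) v * inverse (f x)))"
      for v
      by simp
  qed
qed

text \<open>Supplies the open coordinate domains that the closure rules for \<open>Ck_on\<close>
  require.\<close>

lemma smooth_atlas_open_image:
  assumes "smooth_atlas A" "(U, \<phi>) \<in> A" "open S"
  shows "open (\<phi> ` (S \<inter> U))"
proof -
  have U: "open U" "open (\<phi> ` U)" "homeomorphism U (\<phi> ` U) \<phi> (inv_into U \<phi>)"
    using assms(1,2) unfolding smooth_atlas_def by auto
  have "openin (top_of_set U) (S \<inter> U)"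
    using assms(3) by (auto simp: openin_open)
  then have "openin (top_of_set (\<phi> ` U)) (\<phi> ` (S \<inter> U))"
    using homeomorphism_imp_open_map[OF U(3)] by blast
  then show ?thesis
    using U(2) openin_open_eq by blast
qed

lemma smooth_atlas_inv_into:
  assumes "smooth_atlas A" "(U, \<phi>) \<in> A" "z \<in> \<phi> ` (S \<inter> U)"
  shows "inv_into U \<phi> z \<in> S"
proof -
  have "homeomorphism U (\<phi> ` U) \<phi> (inv_into U \<phi>)"
    using assms(1,2) unfolding smooth_atlas_def by auto
  then show ?thesis
    using assms(3) by (auto simp: homeomorphism_def)
qed

lemma smooth_fun_on_subset:
  assumes "smooth_fun_on A S f" "T \<subseteq> S"
  shows "smooth_fun_on A T f"
  unfolding smooth_fun_on_def Cinf_on_def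
proof (clarify)
  fix U \<phi> k assume "(U, \<phi>) \<in> A"
  then have "Ck_on k (\<phi> ` (S \<inter> U)) (f \<circ> inv_into U \<phi>)"
    using assms(1) unfolding smooth_fun_on_def Cinf_on_def by auto
  then show "Ck_on k (\<phi> ` (T \<inter> U)) (f \<circ> inv_into U \<phi>)"
    by (rule Ck_on_subset) (use assms(2) in blast)
qed

context
  fixes A :: "('a::{t2_space,second_countable_topology}, 'e::euclidean_space) chart set"
  assumes atlas: "smooth_atlas A"
begin

lemma smooth_fun_on_cong:
  assumes "open S" "smooth_fun_on A S f" "\<And>x. x \<in> S \<Longrightarrow> f x = h x"
  shows "smooth_fun_on A S h"
  unfolding smooth_fun_on_def Cinf_on_def
proof (clarify)
  fix U \<phi> k assume U: "(U, \<phi>) \<in> A"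
  show "Ck_on k (\<phi> ` (S \<inter> U)) (h \<circ> inv_into U \<phi>)"
  proof (rule Ck_on_cong[OF smooth_atlas_open_image[OF atlas U assms(1)]])
    show "Ck_on k (\<phi> ` (S \<inter> U)) (f \<circ> inv_into U \<phi>)"
      using assms(2) U unfolding smooth_fun_on_def Cinf_on_def by auto
    show "(f \<circ> inv_into U \<phi>) z = (h \<circ> inv_into U \<phi>) z" if "z \<in> \<phi> ` (S \<inter> U)" for z
      using smooth_atlas_inv_into[OF atlas U that] assms(3) by simp
  qed
qed

lemma smooth_fun_locally:
  assumes "\<And>x. \<exists>S. open S \<and> x \<in> S \<and> smooth_fun_on A S f"
  shows "smooth_fun A f"
  unfolding smooth_fun_on_def Cinf_on_def
proof (clarify)
  fix U \<phi> k assume U: "(U, \<phi>) \<in> A"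
  show "Ck_on k (\<phi> ` (UNIV \<inter> U)) (f \<circ> inv_into U \<phi>)"
  proof (rule Ck_on_locally)
    fix z assume "z \<in> \<phi> ` (UNIV \<inter> U)"
    then obtain x where x: "x \<in> U" "z = \<phi> x" by auto
    obtain S where S: "open S" "x \<in> S" "smooth_fun_on A S f"
      using assms by blast
    show "\<exists>T. open T \<and> z \<in> T \<and> Ck_on k T (f \<circ> inv_into U \<phi>)"
    proof (intro exI conjI)
      show "open (\<phi> ` (S \<inter> U))"
        by (rule smooth_atlas_open_image[OF atlas U S(1)])
      show "z \<in> \<phi> ` (S \<inter> U)"
        using x S by auto
      show "Ck_on k (\<phi> ` (S \<inter> U)) (f \<circ> inv_into U \<phi>)"
        using S(3) U unfolding smooth_fun_on_def Cinf_on_def by auto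
    qed
  qed
qed

lemma smooth_fun_on_const: "smooth_fun_on A S (\<lambda>x. c)"
  unfolding smooth_fun_on_def Cinf_on_def by (auto simp: comp_def Ck_on_const)

lemma smooth_fun_on_add:
  assumes "open S" "smooth_fun_on A S f" "smooth_fun_on A S h"
  shows "smooth_fun_on A S (\<lambda>x. f x + h x)"
  unfolding smooth_fun_on_def Cinf_on_def comp_def
proof (clarify)
  fix U \<phi> k assume U: "(U, \<phi>) \<in> A"
  show "Ck_on k (\<phi> ` (S \<inter> U)) (\<lambda>z. f (inv_into U \<phi> z) + h (inv_into U \<phi> z))"
    using assms U unfolding smooth_fun_on_def Cinf_on_def comp_def
    by (intro Ck_on_add smooth_atlas_open_image[OF atlas U assms(1)]) auto
qed

lemma smooth_fun_on_mult:
  assumes "open S" "smooth_fun_on A S f" "smooth_fun_on A S h"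
  shows "smooth_fun_on A S (\<lambda>x. f x * h x)"
  unfolding smooth_fun_on_def Cinf_on_def comp_def
proof (clarify)
  fix U \<phi> k assume U: "(U, \<phi>) \<in> A"
  show "Ck_on k (\<phi> ` (S \<inter> U)) (\<lambda>z. f (inv_into U \<phi> z) * h (inv_into U \<phi> z))"
    using assms U unfolding smooth_fun_on_def Cinf_on_def comp_def
    by (intro Ck_on_mult smooth_atlas_open_image[OF atlas U assms(1)]) auto
qed

lemma smooth_fun_on_inverse:
  assumes "open S" "smooth_fun_on A S f" "\<And>x. x \<in> S \<Longrightarrow> f x \<noteq> 0"
  shows "smooth_fun_on A S (\<lambda>x. inverse (f x))"
  unfolding smooth_fun_on_def Cinf_on_def comp_def
proof (clarify)
  fix U \<phi> k assume U: "(U, \<phi>) \<in> A"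
  show "Ck_on k (\<phi> ` (S \<inter> U)) (\<lambda>z. inverse (f (inv_into U \<phi> z)))"
    using assms U smooth_atlas_inv_into[OF atlas U]
    unfolding smooth_fun_on_def Cinf_on_def comp_def
    by (intro Ck_on_inverse smooth_atlas_open_image[OF atlas U assms(1)]) auto
qed

end

section \<open>Vector fields and distributions\<close>

lemma subspace_tangent_space: "subspace (tangent_space A x)"
  unfolding subspace_def tangent_space_def
  by (auto simp: scaleR_fun_def zero_fun_def plus_fun_def algebra_simps)

lemma smooth_vfield_on_subset:
  assumes "smooth_vfield_on A S X" "T \<subseteq> S"
  shows "smooth_vfield_on A T X"
  using assms smooth_fun_on_subset[OF _ assms(2)] unfolding smooth_vfield_on_def by blast

context
  fixes A :: "('a::{t2_space,second_countable_topology}, 'e::euclidean_space) chart set"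
  assumes atlas: "smooth_atlas A"
begin

lemma smooth_vfield_on_zero: "smooth_vfield_on A S (\<lambda>x. 0)"
  unfolding smooth_vfield_on_def
  using subspace_0[OF subspace_tangent_space] smooth_fun_on_const[of A S 0]
  by (auto simp: zero_fun_def atlas)

lemma smooth_vfield_on_add:
  assumes "open S" "smooth_vfield_on A S X" "smooth_vfield_on A S Y"
  shows "smooth_vfield_on A S (\<lambda>x. X x + Y x)"
  unfolding smooth_vfield_on_def
proof (intro conjI ballI allI impI)
  show "X x + Y x \<in> tangent_space A x" if "x \<in> S" for x
    using assms(2,3) that subspace_add[OF subspace_tangent_space]
    unfolding smooth_vfield_on_def by blast
  show "smooth_fun_on A S (\<lambda>x. (X x + Y x) f)" if "smooth_fun A f" for f
    using assms that unfolding smooth_vfield_on_def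
    by (simp add: smooth_fun_on_add[OF atlas])
qed

lemma smooth_vfield_on_scaleR:
  assumes "open S" "smooth_fun_on A S c" "smooth_vfield_on A S X"
  shows "smooth_vfield_on A S (\<lambda>x. c x *\<^sub>R X x)"
  unfolding smooth_vfield_on_def
proof (intro conjI ballI allI impI)
  show "c x *\<^sub>R X x \<in> tangent_space A x" if "x \<in> S" for x
    using assms(3) that subspace_scale[OF subspace_tangent_space]
    unfolding smooth_vfield_on_def by blast
  show "smooth_fun_on A S (\<lambda>x. (c x *\<^sub>R X x) f)" if "smooth_fun A f" for f
    using assms that unfolding smooth_vfield_on_def
    by (simp add: scaleR_fun_def smooth_fun_on_mult[OF atlas])
qed

lemma smooth_vfield_on_diff:
  assumes "open S" "smooth_vfield_on A S X" "smooth_vfield_on A S Y"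
  shows "smooth_vfield_on A S (\<lambda>x. X x - Y x)"
  using smooth_vfield_on_add[OF assms(1,2) smooth_vfield_on_scaleR[OF assms(1)
        smooth_fun_on_const[OF atlas, of S "-1"] assms(3)]]
  by simp

end

section \<open>Pointwise algebra of the metric and projection onto a local frame\<close>

locale riemannian =
  fixes A :: "('a::{t2_space,second_countable_topology}, 'e::euclidean_space) chart set"
    and g :: "'a \<Rightarrow> 'a tangent \<Rightarrow> 'a tangent \<Rightarrow> real"
  assumes riemannian: "riemannian_manifold A g"
begin

lemma atlas: "smooth_atlas A"
  and metric: "riemannian_metric A g"
  using riemannian unfolding riemannian_manifold_def by auto

lemma metric_sym:
  assumes "u \<in> tangent_space A x" "v \<in> tangent_space A x"
  shows "g x u v = g x v u"
  using metric assms unfolding riemannian_metric_def by blast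

lemma metric_pos:
  assumes "u \<in> tangent_space A x" "u \<noteq> 0"
  shows "g x u u > 0"
  using metric assms unfolding riemannian_metric_def by blast

lemma metric_lin:
  assumes "u \<in> tangent_space A x" "v \<in> tangent_space A x" "w \<in> tangent_space A x"
  shows "g x (a *\<^sub>R u + b *\<^sub>R v) w = a * g x u w + b * g x v w"
  using metric assms unfolding riemannian_metric_def by blast

lemma metric_add:
  assumes "u \<in> tangent_space A x" "v \<in> tangent_space A x" "w \<in> tangent_space A x"
  shows "g x (u + v) w = g x u w + g x v w"
  using metric_lin[OF assms, of 1 1] by simp

lemma metric_diff:
  assumes "u \<in> tangent_space A x" "v \<in> tangent_space A x" "w \<in> tangent_space A x"
  shows "g x (u - v) w = g x u w - g x v w"
  using metric_lin[OF assms, of 1 "-1"] by simp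

lemma metric_scaleR:
  assumes "u \<in> tangent_space A x" "w \<in> tangent_space A x"
  shows "g x (a *\<^sub>R u) w = a * g x u w"
  using metric_lin[OF assms(1,1,2), of a 0] by simp

lemma metric_zero:
  assumes "w \<in> tangent_space A x"
  shows "g x 0 w = 0"
  using metric_scaleR[OF assms assms, of 0] by simp

text \<open>Kept local because it is applied to fields made from a frame, which is smooth only on
  \<open>S\<close>.\<close>

lemma smooth_metric:
  assumes "open S" "smooth_vfield_on A S X" "smooth_vfield_on A S Y"
  shows "smooth_fun_on A S (\<lambda>x. g x (X x) (Y x))"
  using metric assms unfolding riemannian_metric_def by blast

lemma orth_span_zero:
  assumes "\<And>v. v \<in> G \<Longrightarrow> v \<in> tangent_space A x \<and> g x v w = 0" "w \<in> tangent_space A x"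
    and "u \<in> span G"
  shows "g x u w = 0"
proof -
  \<comment> \<open>Tangency is carried through the induction because the metric is linear only on
    tangent vectors.\<close>
  have "u \<in> tangent_space A x \<and> g x u w = 0"
    using assms(3)
  proof (induction rule: span_induct_alt)
    case base
    then show ?case
      by (intro conjI metric_zero[OF assms(2)] subspace_0[OF subspace_tangent_space])
  next
    case (step c v u)
    have v: "v \<in> tangent_space A x" "g x v w = 0"
      using assms(1)[OF step(1)] by auto
    show ?case
      using step(2) v metric_lin[OF v(1) _ assms(2), of u c 1]
        subspace_add[OF subspace_tangent_space subspace_scale[OF subspace_tangent_space v(1)]]
      by (metis (no_types, lifting) add.right_neutral mult_zero_right scaleR_one)
  qed
  then show ?thesis by simp
qed

text \<open>Gram--Schmidt without an orthogonal frame: projecting onto the span of \<open>k + 1\<close> fields is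
  projecting onto the span of the first \<open>k\<close> and then correcting along the component of the last
  field that is normal to them.\<close>

lemma smooth_projection_frame:
  assumes "open S" "\<And>i. i < k \<Longrightarrow> smooth_vfield_on A S (E i)"
    and "\<And>y. y \<in> S \<Longrightarrow> inj_on (\<lambda>i. E i y) {..<k::nat}"
    and "\<And>y. y \<in> S \<Longrightarrow> independent ((\<lambda>i. E i y) ` {..<k})"
    and "smooth_vfield_on A S Y"
  shows "\<exists>P. smooth_vfield_on A S P \<and>
    (\<forall>y\<in>S. P y \<in> span ((\<lambda>i. E i y) ` {..<k}) \<and> (\<forall>i<k. g y (E i y) (Y y - P y) = 0))"
  using assms(2-5)
proof (induction k arbitrary: Y)
  case 0
  then show ?case
    using span_zero by (intro exI[of _ "\<lambda>x. 0"] conjI smooth_vfield_on_zero[OF atlas]) blast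
next
  case (Suc k)
  have tan: "X y \<in> tangent_space A y" if "smooth_vfield_on A S X" "y \<in> S" for X y
    using that unfolding smooth_vfield_on_def by blast
  have E: "smooth_vfield_on A S (E i)" if "i \<le> k" for i
    using Suc.prems(1) that by simp
  have inj: "inj_on (\<lambda>i. E i y) {..<k}" if "y \<in> S" for y
    using Suc.prems(2)[OF that] by (rule inj_on_subset) auto
  have ind: "independent ((\<lambda>i. E i y) ` {..<k})" if "y \<in> S" for y
    using Suc.prems(3)[OF that] by (rule independent_mono) auto
  note IH = Suc.IH[OF E inj ind]
  \<comment> \<open>The induction hypothesis is used for two fields: \<open>Q\<close> projects the
    new frame field \<open>E k\<close>, and \<open>R\<close> below projects \<open>Y\<close>, both
    onto the span of the first \<open>k\<close> fields.\<close>
  obtain Q where Q: "smooth_vfield_on A S Q"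
    "\<And>y. y \<in> S \<Longrightarrow> Q y \<in> span ((\<lambda>i. E i y) ` {..<k})"
    "\<And>y i. y \<in> S \<Longrightarrow> i < k \<Longrightarrow> g y (E i y) (E k y - Q y) = 0"
    using IH[OF _ _ _ E[OF order_refl]] by (metis less_imp_le)
  obtain R where R: "smooth_vfield_on A S R"
    "\<And>y. y \<in> S \<Longrightarrow> R y \<in> span ((\<lambda>i. E i y) ` {..<k})"
    "\<And>y i. y \<in> S \<Longrightarrow> i < k \<Longrightarrow> g y (E i y) (Y y - R y) = 0"
    using IH[OF _ _ _ Suc.prems(4)] by (metis less_imp_le)
  define e where "e = (\<lambda>y. E k y - Q y)"
  have e: "smooth_vfield_on A S e"
    unfolding e_def by (rule smooth_vfield_on_diff[OF atlas \<open>open S\<close> E[OF order_refl] Q(1)])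
  have e0: "e y \<noteq> 0" if y: "y \<in> S" for y
  proof
    assume "e y = 0"
    then have "E k y \<in> span ((\<lambda>i. E i y) ` {..<k})"
      using Q(2)[OF y] by (simp add: e_def)
    \<comment> \<open>Independence concerns the image set and would not exclude a repeated vector;
      injectivity of the indexing does.\<close>
    moreover have "E k y \<notin> (\<lambda>i. E i y) ` {..<k}"
    proof
      assume "E k y \<in> (\<lambda>i. E i y) ` {..<k}"
      then obtain i where "i < k" "E k y = E i y" by auto
      then show False
        using inj_onD[OF Suc.prems(2)[OF y], of k i] by simp
    qed
    ultimately show False
      using Suc.prems(3)[OF y] by (simp add: lessThan_Suc independent_insert)
  qed
  have ee: "g y (e y) (e y) \<noteq> 0" if "y \<in> S" for y
    using metric_pos[OF tan[OF e that] e0[OF that]] by simp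
  \<comment> \<open>The Gram-Schmidt coefficient of \<open>Y\<close> along \<open>e\<close>; its
    denominator is a nowhere vanishing smooth function on \<open>S\<close>.\<close>
  define c where "c = (\<lambda>y. g y (Y y) (e y) * inverse (g y (e y) (e y)))"
  have c: "smooth_fun_on A S c"
    unfolding c_def using \<open>open S\<close> e Suc.prems(4) ee
    by (intro smooth_fun_on_mult[OF atlas] smooth_fun_on_inverse[OF atlas] smooth_metric) auto
  define P where "P = (\<lambda>y. R y + c y *\<^sub>R e y)"
  have P: "smooth_vfield_on A S P"
    unfolding P_def
    by (intro smooth_vfield_on_add[OF atlas] smooth_vfield_on_scaleR[OF atlas] \<open>open S\<close> R(1) c e)
  show ?case
  proof (intro exI[of _ P] conjI ballI P allI impI)
    fix y assume y: "y \<in> S"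
    let ?G = "(\<lambda>i. E i y) ` {..<k}"
    note T = tan[OF _ y]
    have sub: "span ?G \<subseteq> span ((\<lambda>i. E i y) ` {..<Suc k})"
      by (rule span_mono) auto
    have "E k y \<in> span ((\<lambda>i. E i y) ` {..<Suc k})"
      by (rule span_base) auto
    then show "P y \<in> span ((\<lambda>i. E i y) ` {..<Suc k})"
      unfolding P_def e_def using Q(2)[OF y] R(2)[OF y] sub
      by (intro span_add span_scale span_diff) auto
    have tE: "E i y \<in> tangent_space A y" if "i \<le> k" for i
      using T[OF E[OF that]] .
    note te = T[OF e] and tY = T[OF Suc.prems(4)] and tR = T[OF R(1)] and tQ = T[OF Q(1)]
      and tP = T[OF P]
    have tYR: "Y y - R y \<in> tangent_space A y" and tYP: "Y y - P y \<in> tangent_space A y"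
      and tce: "c y *\<^sub>R e y \<in> tangent_space A y"
      by (intro subspace_diff[OF subspace_tangent_space] subspace_scale[OF subspace_tangent_space]
          te tY tR tP)+
    have YP: "Y y - P y = (Y y - R y) - c y *\<^sub>R e y"
      by (simp add: P_def)
    \<comment> \<open>Linearity is available in the first slot of the metric only, so every product
      is flipped by symmetry before it is expanded.\<close>
    have split: "g y u (Y y - P y) = g y u (Y y - R y) - c y * g y u (e y)"
      if u: "u \<in> tangent_space A y" for u
      unfolding metric_sym[OF u tYP] metric_sym[OF u tYR] metric_sym[OF u te] unfolding YP
      by (simp add: metric_diff[OF tYR tce u] metric_scaleR[OF te u])
    have low: "g y (E i y) (Y y - P y) = 0" if "i < k" for i
      using split[OF tE] that R(3)[OF y that] Q(3)[OF y that] by (simp add: e_def)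
    have Qe: "g y (Q y) (Y y - P y) = 0"
      by (rule orth_span_zero[OF _ tYP Q(2)[OF y]]) (use low tE in auto)
    have Re: "g y (R y) (e y) = 0"
      by (rule orth_span_zero[OF _ te R(2)[OF y]]) (use Q(3)[OF y] tE in \<open>auto simp: e_def\<close>)
    \<comment> \<open>Since \<open>e\<close> is normal to \<open>R\<close>, replacing
      \<open>Y\<close> by \<open>Y - R\<close> leaves its product with \<open>e\<close> unchanged,
      and subtracting \<open>c\<close> times the squared length of \<open>e\<close> then cancels it
      exactly.\<close>
    have "g y (e y) (Y y - R y) = g y (Y y) (e y)"
      unfolding metric_sym[OF te tYR] using metric_diff[OF tY tR te] Re by simp
    then have "g y (e y) (Y y - P y) = 0"
      using split[OF te] ee[OF y] by (simp add: c_def)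
    moreover have "E k y = e y + Q y"
      by (simp add: e_def)
    ultimately have top: "g y (E k y) (Y y - P y) = 0"
      using metric_add[OF te tQ tYP] Qe by simp
    show "g y (E i y) (Y y - P y) = 0" if "i < Suc k" for i
      using low top that less_Suc_eq by auto
  qed
qed

end

section \<open>Global projections onto a distribution and its orthogonal complement\<close>

locale riemannian_distribution = riemannian A g
  for A :: "('a::{t2_space,second_countable_topology}, 'e::euclidean_space) chart set"
    and g :: "'a \<Rightarrow> 'a tangent \<Rightarrow> 'a tangent \<Rightarrow> real" +
  fixes D :: "'a \<Rightarrow> 'a tangent set"
  assumes distribution: "smooth_distribution A D"
begin

abbreviation "tanD \<equiv> tan_part A g D"
abbreviation "norD \<equiv> nor_part A g D"
abbreviation "Dperp \<equiv> orth A g D"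

lemma local_frame:
  obtains S k E where "open S" "x \<in> S" "\<And>i. i < k \<Longrightarrow> smooth_vfield_on A S (E i)"
    "\<And>y. y \<in> S \<Longrightarrow> inj_on (\<lambda>i. E i y) {..<k::nat}"
    "\<And>y. y \<in> S \<Longrightarrow> independent ((\<lambda>i. E i y) ` {..<k})"
    "\<And>y. y \<in> S \<Longrightarrow> D y = span ((\<lambda>i. E i y) ` {..<k})"
proof -
  obtain S k E where *: "open S \<and> x \<in> S \<and> (\<forall>i<k. smooth_vfield_on A S (E i)) \<and>
     (\<forall>y\<in>S. inj_on (\<lambda>i. E i y) {..<k::nat} \<and> independent ((\<lambda>i. E i y) ` {..<k}) \<and>
            D y = span ((\<lambda>i. E i y) ` {..<k}))"
    using distribution[unfolded smooth_distribution_def, THEN spec, of x] by (elim exE)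
  show thesis
    by (rule that[of S k E]) (use * in blast)+
qed

lemma subspace_D: "subspace (D x)"
  and D_tangent: "D x \<subseteq> tangent_space A x"
proof -
  obtain S k E where S: "x \<in> S" "\<And>i. i < k \<Longrightarrow> smooth_vfield_on A S (E i)"
    "D x = span ((\<lambda>i. E i x) ` {..<k::nat})"
    by (rule local_frame[of x]) blast
  show "subspace (D x)"
    using S(3) by simp
  show "D x \<subseteq> tangent_space A x"
    unfolding S(3) using S(1,2)
    by (intro span_minimal subspace_tangent_space) (auto simp: smooth_vfield_on_def)
qed

lemma subspace_Dperp: "subspace (Dperp x)"
proof (rule subspaceI)
  have "g x w 0 = 0" if "w \<in> D x" for w
  proof -
    have w: "w \<in> tangent_space A x"
      using that D_tangent by blast
    show ?thesis
      unfolding metric_sym[OF w subspace_0[OF subspace_tangent_space]] by (rule metric_zero[OF w])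
  qed
  then show "0 \<in> Dperp x"
    unfolding orth_def using subspace_0[OF subspace_tangent_space] by blast
next
  fix u v assume uv: "u \<in> Dperp x" "v \<in> Dperp x"
  then have t: "u \<in> tangent_space A x" "v \<in> tangent_space A x"
    unfolding orth_def by auto
  have s: "u + v \<in> tangent_space A x"
    by (rule subspace_add[OF subspace_tangent_space t])
  have "g x w (u + v) = 0" if w: "w \<in> D x" for w
  proof -
    have tw: "w \<in> tangent_space A x"
      using w D_tangent by blast
    have "g x u w = 0" "g x v w = 0"
      unfolding metric_sym[OF t(1) tw] metric_sym[OF t(2) tw]
      using uv w unfolding orth_def by blast+
    then show ?thesis
      unfolding metric_sym[OF tw s] metric_add[OF t tw] by simp
  qed
  with s show "u + v \<in> Dperp x"
    unfolding orth_def by blast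
next
  fix c u assume u: "u \<in> Dperp x"
  then have t: "u \<in> tangent_space A x"
    unfolding orth_def by auto
  have s: "c *\<^sub>R u \<in> tangent_space A x"
    by (rule subspace_scale[OF subspace_tangent_space t])
  have "g x w (c *\<^sub>R u) = 0" if w: "w \<in> D x" for w
  proof -
    have tw: "w \<in> tangent_space A x"
      using w D_tangent by blast
    have "g x u w = 0"
      unfolding metric_sym[OF t tw] using u w unfolding orth_def by blast
    then show ?thesis
      unfolding metric_sym[OF tw s] metric_scaleR[OF t tw] by simp
  qed
  with s show "c *\<^sub>R u \<in> Dperp x"
    unfolding orth_def by blast
qed

lemma D_Int_Dperp:
  assumes "u \<in> D x" "u \<in> Dperp x"
  shows "u = 0"
proof (rule ccontr)
  assume "u \<noteq> 0"
  then have "g x u u > 0"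
    using metric_pos D_tangent assms(1) by blast
  moreover have "g x u u = 0"
    using assms unfolding orth_def by blast
  ultimately show False by simp
qed

text \<open>Two tangential candidates differ by a vector lying both in \<open>D x\<close> and in its
  complement. This gives the definite descriptions their meaning and identifies them with any local
  projection.\<close>

lemma decomposition_unique:
  assumes "u \<in> D x" "w - u \<in> Dperp x" "u' \<in> D x" "w - u' \<in> Dperp x"
  shows "u = u'"
proof -
  have "u - u' \<in> D x"
    by (rule subspace_diff[OF subspace_D assms(1,3)])
  moreover have "(w - u') - (w - u) \<in> Dperp x"
    by (rule subspace_diff[OF subspace_Dperp assms(4,2)])
  moreover have "(w - u') - (w - u) = u - u'"
    by (simp add: fun_eq_iff)
  ultimately have "u - u' = 0"
    using D_Int_Dperp[of "u - u'" x] by argo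
  then show ?thesis by simp
qed

lemma tan_part_eq:
  assumes "u \<in> D x" "w - u \<in> Dperp x"
  shows "tanD x w = u"
  unfolding tan_part_def
  by (rule the_equality) (use assms decomposition_unique in blast)+

lemma nor_part_eq:
  assumes "u \<in> D x" "w - u \<in> Dperp x"
  shows "norD x w = w - u"
  unfolding nor_part_def
proof (rule the_equality)
  fix v assume v: "v \<in> Dperp x \<and> w - v \<in> D x"
  have "w - (w - v) = v"
    by simp
  then have "w - v = u"
    using v decomposition_unique[OF _ _ assms, of "w - v"] by argo
  then show "v = w - u"
    by (simp add: algebra_simps)
next
  have "w - (w - u) = u"
    by simp
  then show "w - u \<in> Dperp x \<and> w - (w - u) \<in> D x"
    using assms by argo
qed

text \<open>Orthogonality to the frame extends to its span, which is the fibre of \<open>D\<close>.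
  Both the existence of the decomposition at a point and its smooth dependence on the point come
  from here.\<close>

lemma local_projection:
  assumes "smooth_vfield A Y"
  obtains S P where "open S" "x \<in> S" "smooth_vfield_on A S P"
    "\<And>y. y \<in> S \<Longrightarrow> P y \<in> D y \<and> Y y - P y \<in> Dperp y"
proof -
  obtain S k E where S: "open S" "x \<in> S" "\<And>i. i < k \<Longrightarrow> smooth_vfield_on A S (E i)"
    "\<And>y. y \<in> S \<Longrightarrow> inj_on (\<lambda>i. E i y) {..<k::nat}"
    "\<And>y. y \<in> S \<Longrightarrow> independent ((\<lambda>i. E i y) ` {..<k})"
    "\<And>y. y \<in> S \<Longrightarrow> D y = span ((\<lambda>i. E i y) ` {..<k})"
    by (rule local_frame[of x]) blast
  obtain P where P: "smooth_vfield_on A S P"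
    "\<And>y. y \<in> S \<Longrightarrow> P y \<in> span ((\<lambda>i. E i y) ` {..<k})"
    "\<And>y i. y \<in> S \<Longrightarrow> i < k \<Longrightarrow> g y (E i y) (Y y - P y) = 0"
    using smooth_projection_frame[OF S(1,3,4,5) smooth_vfield_on_subset[OF assms]] by blast
  show thesis
  proof (rule that[OF S(1,2) P(1)])
    fix y assume y: "y \<in> S"
    have t: "Y y - P y \<in> tangent_space A y"
      using assms P(1) y subspace_diff[OF subspace_tangent_space]
      unfolding smooth_vfield_on_def by blast
    have E: "E i y \<in> tangent_space A y" if "i < k" for i
      using S(3)[OF that] y unfolding smooth_vfield_on_def by blast
    have "g y u (Y y - P y) = 0" if "u \<in> D y" for u
      by (rule orth_span_zero[OF _ t that[unfolded S(6)[OF y]]]) (use E P(3)[OF y] in auto)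
    then show "P y \<in> D y \<and> Y y - P y \<in> Dperp y"
      using P(2)[OF y] S(6)[OF y] t unfolding orth_def by blast
  qed
qed

text \<open>Formulated for values of a smooth field, since existence of the decomposition is
  obtained by projecting that field near \<open>y\<close>.\<close>

lemma projection:
  assumes "smooth_vfield A Y"
  shows tan_part_in: "tanD y (Y y) \<in> D y"
    and nor_part_in: "norD y (Y y) \<in> Dperp y"
    and nor_part_diff: "norD y (Y y) = Y y - tanD y (Y y)"
    and tan_add_nor: "tanD y (Y y) + norD y (Y y) = Y y"
proof -
  obtain u where u: "u \<in> D y" "Y y - u \<in> Dperp y"
    using local_projection[OF assms, of y] by blast
  show "tanD y (Y y) \<in> D y" "norD y (Y y) \<in> Dperp y" "norD y (Y y) = Y y - tanD y (Y y)"
    "tanD y (Y y) + norD y (Y y) = Y y"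
    unfolding tan_part_eq[OF u] nor_part_eq[OF u] by (rule u refl | simp)+
qed

text \<open>Near each point the pointwise projection coincides, by uniqueness, with a smooth local
  one, and smoothness is a local property.\<close>

lemma tan_part_section:
  assumes "smooth_vfield A Y"
  shows "(\<lambda>y. tanD y (Y y)) \<in> sections A D"
proof -
  have "smooth_fun A (\<lambda>y. tanD y (Y y) f)" if f: "smooth_fun A f" for f
  proof (rule smooth_fun_locally[OF atlas])
    fix x
    obtain S P where P: "open S" "x \<in> S" "smooth_vfield_on A S P"
      "\<And>y. y \<in> S \<Longrightarrow> P y \<in> D y \<and> Y y - P y \<in> Dperp y"
      using local_projection[OF assms] by blast
    have "smooth_fun_on A S (\<lambda>y. P y f)"
      using P(3) f unfolding smooth_vfield_on_def by blast
    then have "smooth_fun_on A S (\<lambda>y. tanD y (Y y) f)"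
      by (rule smooth_fun_on_cong[OF atlas P(1)]) (use P(4) tan_part_eq in metis)
    with P(1,2) show "\<exists>S. open S \<and> x \<in> S \<and> smooth_fun_on A S (\<lambda>y. tanD y (Y y) f)"
      by blast
  qed
  then show ?thesis
    using tan_part_in[OF assms] D_tangent unfolding sections_def smooth_vfield_on_def by blast
qed

lemma nor_part_section:
  assumes "smooth_vfield A Y"
  shows "(\<lambda>y. norD y (Y y)) \<in> sections A Dperp"
proof -
  have "smooth_vfield A (\<lambda>y. Y y - tanD y (Y y))"
    using smooth_vfield_on_diff[OF atlas open_UNIV assms] tan_part_section[OF assms]
    unfolding sections_def by blast
  then show ?thesis
    using nor_part_in[OF assms] unfolding sections_def nor_part_diff[OF assms, symmetric] by blast
qed

lemma sections_uminus:
  assumes "Y \<in> sections A D"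
  shows "(\<lambda>y. - Y y) \<in> sections A D"
proof -
  have "smooth_vfield A (\<lambda>y. (-1) *\<^sub>R Y y)"
    using assms unfolding sections_def
    by (intro smooth_vfield_on_scaleR[OF atlas open_UNIV] smooth_fun_on_const[OF atlas]) blast
  then show ?thesis
    using assms subspace_neg[OF subspace_D] unfolding sections_def by simp
qed

end

section \<open>Totally geodesic orthogonal complements\<close>

locale totally_geodesic_complement = riemannian_distribution A g D
  for A :: "('a::{t2_space,second_countable_topology}, 'e::euclidean_space) chart set"
    and g :: "'a \<Rightarrow> 'a tangent \<Rightarrow> 'a tangent \<Rightarrow> real" and D :: "'a \<Rightarrow> 'a tangent set" +
  fixes nabla :: "'a connection"
  assumes levi_civita: "levi_civita A g nabla"
    and totally_geodesic: "orth_totally_geodesic A g D nabla"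
begin

abbreviation "S \<equiv> shape A g D nabla"
abbreviation "N \<equiv> nor_cov A g D nabla"

lemma affine: "affine_connection A nabla"
  using levi_civita unfolding levi_civita_def by blast

lemma smooth_cov:
  assumes "smooth_vfield A Y" "smooth_vfield A W"
  shows "smooth_vfield A (cov nabla Y W)"
  using affine assms unfolding affine_connection_def by blast

lemma nabla_lin:
  assumes "u \<in> tangent_space A x" "v \<in> tangent_space A x" "smooth_vfield A W"
  shows "nabla x (a *\<^sub>R u + b *\<^sub>R v) W = a *\<^sub>R nabla x u W + b *\<^sub>R nabla x v W"
  using affine assms unfolding affine_connection_def by blast

lemma nabla_diff:
  assumes "u \<in> tangent_space A x" "v \<in> tangent_space A x" "smooth_vfield A W"
  shows "nabla x (u - v) W = nabla x u W - nabla x v W"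
  using nabla_lin[OF assms, of 1 "-1"] by simp

lemma nabla_add_field:
  assumes "v \<in> tangent_space A x" "smooth_vfield A W" "smooth_vfield A Z"
  shows "nabla x v (\<lambda>y. W y + Z y) = nabla x v W + nabla x v Z"
  using affine assms unfolding affine_connection_def by blast

lemma shape_section:
  assumes "smooth_vfield A V" "smooth_vfield A Y"
  shows "S V Y \<in> sections A D"
  unfolding shape_def by (intro sections_uminus tan_part_section smooth_cov assms)

lemma nor_cov_section:
  assumes "smooth_vfield A V" "smooth_vfield A Y"
  shows "N Y V \<in> sections A Dperp"
  unfolding nor_cov_def by (intro nor_part_section smooth_cov assms)

lemma cov_decomposition:
  assumes "smooth_vfield A V" "smooth_vfield A Y"
  shows "cov nabla Y V y = N Y V y - S V Y y"
  using tan_add_nor[OF smooth_cov[OF assms(2,1)], of y]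
  unfolding shape_def nor_cov_def by (simp add: algebra_simps)

lemma cov_Dperp:
  assumes "V \<in> sections A Dperp" "W \<in> sections A Dperp"
  shows "cov nabla V W = N V W"
  using totally_geodesic assms unfolding orth_totally_geodesic_def by blast

text \<open>Differentiating \<open>g(Y, U) = 0\<close>, where \<open>U\<close> is the normal part of \<open>\<nabla>\<^sub>V Y\<close> itself, gives
  \<open>g(U, U) = - g(Y, \<nabla>\<^sub>V U) = 0\<close>. This choice of \<open>U\<close> makes it unnecessary to extend
  normal vectors at a point to global sections.\<close>

lemma cov_in_D:
  assumes "V \<in> sections A Dperp" "Y \<in> sections A D"
  shows "cov nabla V Y \<in> sections A D"
proof -
  have V: "smooth_vfield A V" and Y: "smooth_vfield A Y" and YD: "Y x \<in> D x" for x
    using assms unfolding sections_def by auto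
  have sm: "smooth_vfield A (cov nabla V Y)"
    by (rule smooth_cov[OF V Y])
  define U where "U = N V Y"
  have US: "U \<in> sections A Dperp"
    unfolding U_def by (rule nor_cov_section[OF Y V])
  then have U: "smooth_vfield A U" and UD: "U x \<in> Dperp x" for x
    unfolding sections_def by auto
  have "U x = 0" for x
  proof (rule ccontr)
    assume "U x \<noteq> 0"
    have tV: "V x \<in> tangent_space A x"
      using V unfolding smooth_vfield_on_def by blast
    have tU: "U x \<in> tangent_space A x"
      using UD unfolding orth_def by blast
    have "g y (Y y) (U y) = 0" for y
      using YD UD unfolding orth_def by blast
    \<comment> \<open>A derivation kills the zero function by homogeneity; the product
      \<open>0 * 0\<close> matches the shape of that axiom.\<close>
    moreover have "V x (\<lambda>y. 0 * 0) = 0 * V x (\<lambda>y. 0)"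
      using tV smooth_fun_on_const[OF atlas, of UNIV 0] unfolding tangent_space_def by blast
    ultimately have "V x (\<lambda>y. g y (Y y) (U y)) = 0"
      by simp
    moreover have "V x (\<lambda>y. g y (Y y) (U y)) =
        g x (cov nabla V Y x) (U x) + g x (Y x) (cov nabla V U x)"
      using levi_civita V Y U unfolding levi_civita_def by blast
    moreover have "g x (Y x) (cov nabla V U x) = 0"
    proof -
      have "N V U x \<in> Dperp x"
        using nor_cov_section[OF U V] unfolding sections_def by blast
      then show ?thesis
        using YD unfolding cov_Dperp[OF assms(1) US] orth_def by blast
    qed
    moreover have "g x (cov nabla V Y x) (U x) = g x (U x) (U x)"
    proof -
      have T: "tanD x (cov nabla V Y x) \<in> D x"
        by (rule tan_part_in[OF sm])
      have "tanD x (cov nabla V Y x) + U x = cov nabla V Y x"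
        unfolding U_def nor_cov_def by (rule tan_add_nor[OF sm])
      from metric_add[OF subsetD[OF D_tangent T] tU tU, unfolded this]
      have "g x (cov nabla V Y x) (U x) = g x (tanD x (cov nabla V Y x)) (U x) + g x (U x) (U x)" .
      moreover have "g x (tanD x (cov nabla V Y x)) (U x) = 0"
        using T UD unfolding orth_def by blast
      ultimately show ?thesis by simp
    qed
    ultimately show False
      using metric_pos[OF tU \<open>U x \<noteq> 0\<close>] by simp
  qed
  then have nor0: "norD x (cov nabla V Y x) = 0" for x
    unfolding U_def nor_cov_def .
  have "cov nabla V Y x \<in> D x" for x
  proof -
    have eq: "tanD x (cov nabla V Y x) = cov nabla V Y x"
      using tan_add_nor[OF sm, of x] unfolding nor0 add_0_right .
    show ?thesis
      using tan_part_in[OF sm, of x] unfolding eq .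
  qed
  then show ?thesis
    using sm unfolding sections_def by blast
qed

text \<open>The paper's terms \<open>\<nabla>\<^bsup>F\<bottom>\<^esup>\<close> in the direction of
  \<open>{}\<^sup>*F\<^sub>* Z\<close> are \<open>N Z W\<close> because \<open>F\<^sub>* {}\<^sup>*F\<^sub>*\<close> is the identity on \<open>D\<close>.\<close>

lemma curvature_decomposition:
  assumes "Y \<in> sections A D" "V \<in> sections A Dperp" "W \<in> sections A Dperp"
  defines "Z \<equiv> cov nabla V Y"
  shows "curvature A nabla Y V W x =
      - S (N V W) Y x + N Y (N V W) x + cov nabla V (S W Y) x - N V (N Y W) x
      - S W (S V Y) x + N (S V Y) W x - N (N Y V) W x - S W Z x + N Z W x" (is ?decomp)
    and "norD x (curvature A nabla Y V W x) =
      N Y (N V W) x - N V (N Y W) x - N (N Y V) W x + N (S V Y) W x + N Z W x" (is ?normal)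
proof -
  have Y: "smooth_vfield A Y" and V: "smooth_vfield A V" and W: "smooth_vfield A W"
    using assms(1-3) unfolding sections_def by auto
  have Z: "smooth_vfield A Z"
    unfolding Z_def by (rule smooth_cov[OF V Y])
  note sec = shape_section nor_cov_section
  have sm: "smooth_vfield A (S P Q)" "smooth_vfield A (N Q P)"
    if "smooth_vfield A P" "smooth_vfield A Q" for P Q
    using sec[OF that] unfolding sections_def by auto
  have tan: "P x \<in> tangent_space A x" if "smooth_vfield A P" for P
    using that unfolding smooth_vfield_on_def by blast
  have 1: "cov nabla Y (cov nabla V W) x = N Y (N V W) x - S (N V W) Y x"
    unfolding cov_Dperp[OF assms(2,3)] by (rule cov_decomposition[OF sm(2)[OF W V] Y])
  \<comment> \<open>An equality of fields, not just of values at \<open>x\<close>, because the sum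
    is about to be differentiated along \<open>V\<close>; this is where smoothness of
    \<open>S W Y\<close> is needed.\<close>
  have NYW: "N Y W = (\<lambda>y. cov nabla Y W y + S W Y y)"
    unfolding cov_decomposition[OF W Y] by simp
  have "N V (N Y W) x = nabla x (V x) (N Y W)"
    unfolding cov_Dperp[OF assms(2) nor_cov_section[OF W Y], symmetric] cov_def ..
  also have "\<dots> = cov nabla V (cov nabla Y W) x + cov nabla V (S W Y) x"
    unfolding NYW unfolding nabla_add_field[OF tan[OF V] smooth_cov[OF Y W] sm(1)[OF W Y]]
    unfolding cov_def ..
  finally have 2: "cov nabla V (cov nabla Y W) x = N V (N Y W) x - cov nabla V (S W Y) x"
    by (metis add_diff_cancel_right')
  have "lie_bracket A Y V x = cov nabla Y V x - Z x"
    using levi_civita Y V unfolding levi_civita_def Z_def by metis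
  then have "lie_bracket A Y V x = (N Y V x - S V Y x) - Z x"
    unfolding cov_decomposition[OF V Y] .
  \<comment> \<open>The bracket enters only as a direction, so its torsion-free expression at the
    single point \<open>x\<close> suffices.\<close>
  then have "cov nabla (lie_bracket A Y V) W x
      = nabla x (N Y V x - S V Y x) W - nabla x (Z x) W"
    unfolding cov_def
    using nabla_diff[OF subspace_diff[OF subspace_tangent_space
          tan[OF sm(2)[OF V Y]] tan[OF sm(1)[OF V Y]]] tan[OF Z] W] by metis
  also have "\<dots> = cov nabla (N Y V) W x - cov nabla (S V Y) W x - cov nabla Z W x"
    unfolding nabla_diff[OF tan[OF sm(2)[OF V Y]] tan[OF sm(1)[OF V Y]] W] cov_def ..
  \<comment> \<open>The direction \<open>N Y V\<close> is normal, so total geodesy leaves no shape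
    term for it; the other two directions keep theirs.\<close>
  also have "\<dots> = N (N Y V) W x - (N (S V Y) W x - S W (S V Y) x) - (N Z W x - S W Z x)"
    unfolding cov_Dperp[OF nor_cov_section[OF V Y] assms(3)]
      cov_decomposition[OF W sm(1)[OF V Y]] cov_decomposition[OF W Z] ..
  finally have 3: "cov nabla (lie_bracket A Y V) W x = \<dots>" .
  show ?decomp
    unfolding curvature_def 1 2 3 by (simp add: algebra_simps)
  \<comment> \<open>\<open>T\<close> and \<open>H\<close> sort the nine terms by type. The only term
    of \<open>T\<close> not tangential by construction is the derivative of \<open>S W Y\<close>
    along \<open>V\<close>, which is covered by \<open>cov_in_D\<close>.\<close>
  define T where "T = - S (N V W) Y x + cov nabla V (S W Y) x - S W (S V Y) x - S W Z x"
  define H where "H = N Y (N V W) x - N V (N Y W) x - N (N Y V) W x + N (S V Y) W x + N Z W x"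
  have sD: "P x \<in> D x" if "P \<in> sections A D" for P
    using that unfolding sections_def by blast
  have sH: "N Q P x \<in> Dperp x" if "smooth_vfield A P" "smooth_vfield A Q" for P Q
    using sec(2)[OF that] unfolding sections_def by blast
  have "T \<in> D x"
    unfolding T_def
    by (intro subspace_diff[OF subspace_D] subspace_add[OF subspace_D] subspace_neg[OF subspace_D]
        sD cov_in_D[OF assms(2)] shape_section sm V W Y Z)
  moreover have "H \<in> Dperp x"
    unfolding H_def
    by (intro subspace_diff[OF subspace_Dperp] subspace_add[OF subspace_Dperp] sH sm V W Y Z)
  moreover have R: "curvature A nabla Y V W x - T = H"
    unfolding \<open>?decomp\<close> T_def H_def by (simp add: algebra_simps)
  ultimately show ?normal
    using nor_part_eq[of T x "curvature A nabla Y V W x"] unfolding R H_def by simp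
qed

end

section \<open>The adjoint of a Riemannian map\<close>

lemma pushforward_diff:
  "pushforward B F (u - v) = pushforward B F u - pushforward B F v"
  by (auto simp: pushforward_def fun_eq_iff)

text \<open>The isometry condition makes the horizontal lift of \<open>w\<close> satisfy the
  equation that defines the adjoint, and positivity of \<open>gM\<close> makes the solution unique;
  so the adjoint is that lift.\<close>

lemma pushforward_adjoint_push:
  assumes "riemannian A gM" "riemannian_map A gM B gN F" "w \<in> range_at A B F p"
  shows "pushforward B F (adjoint_push A gM B gN F p w) = w"
proof -
  interpret riemannian A gM by fact
  let ?f = "pushforward B F" and ?H = "horizontal_space A gM B F p"
  have onto: "?f ` ?H = range_at A B F p"
    and iso: "\<And>u v. u \<in> ?H \<Longrightarrow> v \<in> ?H \<Longrightarrow> gN (F p) (?f u) (?f v) = gM p u v"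
    using assms(2) unfolding riemannian_map_def by auto
  obtain u where u: "u \<in> ?H" "w = ?f u"
    using assms(3) onto by blast
  have H: "h \<in> tangent_space A p"
    "\<And>v. v \<in> tangent_space A p \<Longrightarrow> ?f v = 0 \<Longrightarrow> gM p v h = 0" if "h \<in> ?H" for h
    using that unfolding horizontal_space_def orth_def by auto
  \<comment> \<open>The isometry condition speaks of horizontal vectors only. A general
    \<open>v\<close> is replaced by a horizontal \<open>h\<close> with the same image; the
    difference lies in the kernel and is orthogonal to \<open>u\<close>.\<close>
  have adj: "gM p u v = gN (F p) w (?f v)" if v: "v \<in> tangent_space A p" for v
  proof -
    obtain h where h: "h \<in> ?H" "?f v = ?f h"
      using onto v unfolding range_at_def by blast
    have t: "v - h \<in> tangent_space A p"
      by (rule subspace_diff[OF subspace_tangent_space v H(1)[OF h(1)]])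
    have "?f (v - h) = 0"
      unfolding pushforward_diff h(2) by (rule diff_self)
    then have "gM p (v - h) u = 0"
      using H(2)[OF u(1) t] by blast
    then have "gM p v u = gM p h u"
      using metric_diff[OF v H(1)[OF h(1)] H(1)[OF u(1)]] by simp
    then show ?thesis
      using iso[OF u(1) h(1)] u(2) h(2) metric_sym[OF v H(1)[OF u(1)]]
        metric_sym[OF H(1)[OF h(1)] H(1)[OF u(1)]] by simp
  qed
  have "adjoint_push A gM B gN F p w = u"
    unfolding adjoint_push_def
  proof (rule the_equality)
    show "u \<in> tangent_space A p \<and> (\<forall>v\<in>tangent_space A p. gM p u v = gN (F p) w (?f v))"
      using adj H(1)[OF u(1)] by blast
    fix u' assume u': "u' \<in> tangent_space A p \<and>
      (\<forall>v\<in>tangent_space A p. gM p u' v = gN (F p) w (?f v))"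
    have t: "u' - u \<in> tangent_space A p"
      using subspace_diff[OF subspace_tangent_space] u' H(1)[OF u(1)] by blast
    \<comment> \<open>Both solutions have the same product with every tangent vector, in particular
      with their own difference.\<close>
    have "gM p (u' - u) (u' - u) = 0"
      using metric_diff[OF _ H(1)[OF u(1)] t] u' adj[OF t] t by simp
    then have "u' - u = 0"
      using metric_pos[OF t] by force
    then show "u' = u"
      by (metis eq_iff_diff_eq_0)
  qed
  with u(2) show ?thesis by simp
qed

theorem proposition3p1:
  fixes A :: "('a::{t2_space,second_countable_topology}, 'e::euclidean_space) chart set"
    and B :: "('b::{t2_space,second_countable_topology}, 'f::euclidean_space) chart set"
    and gM :: "'a \<Rightarrow> 'a tangent \<Rightarrow> 'a tangent \<Rightarrow> real"
    and gN :: "'b \<Rightarrow> 'b tangent \<Rightarrow> 'b tangent \<Rightarrow> real"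
    and F :: "'a \<Rightarrow> 'b" and D :: "'b \<Rightarrow> 'b tangent set" and nabla :: "'b connection"
    and X :: "'a vfield" and FX V W :: "'b vfield" and p :: 'a
  assumes "riemannian_manifold A gM" and "riemannian_manifold B gN"
    and "riemannian_map A gM B gN F"
    and "levi_civita B gN nabla"
    and "range_distribution A B F D"
    and "orth_totally_geodesic B gN D nabla"
    and "smooth_vfield A X"
    and "FX \<in> sections B D" and "FX (F p) = pushforward B F (X p)"
    and "V \<in> sections B (orth B gN D)" and "W \<in> sections B (orth B gN D)"
  shows "let S = shape B gN D nabla;
             N = nor_cov B gN D nabla;
             NF = nor_cov_along B gN D nabla F;
             adj = (\<lambda>Y r. adjoint_push A gM B gN F r (Y (F r)));
             q = F p
         in curvature B nabla FX V W q =
              - S (N V W) FX q + NF X (N V W) p + cov nabla V (S W FX) q - N V (N FX W) q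
              - S W (S V FX) q + NF (adj (S V FX)) W p - N (N FX V) W q
              - S W (cov nabla V FX) q + NF (adj (cov nabla V FX)) W p
          \<and> nor_part B gN D q (curvature B nabla FX V W q) =
              NF X (N V W) p - N V (N FX W) q - N (N FX V) W q
              + NF (adj (S V FX)) W p + NF (adj (cov nabla V FX)) W p"
proof -
  interpret riemannian_distribution B gN D
    using assms(2,5) unfolding range_distribution_def by unfold_locales auto
  interpret totally_geodesic_complement B gN D nabla
    using assms(4,6) by unfold_locales auto
  have "riemannian A gM"
    using assms(1) by unfold_locales
  \<comment> \<open>The fibre of \<open>D\<close> over \<open>F p\<close> is the range of the
    differential at \<open>p\<close>, so values of sections of \<open>D\<close> there are admissible
    for the left inverse.\<close>
  then have push: "pushforward B F (adjoint_push A gM B gN F p (Y (F p))) = Y (F p)"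
    if "Y \<in> sections B D" for Y
    by (rule pushforward_adjoint_push[OF _ assms(3)])
      (use that assms(5) in \<open>auto simp: sections_def range_distribution_def\<close>)
  have adj: "nor_cov_along B gN D nabla F (\<lambda>r. adjoint_push A gM B gN F r (Y (F r))) W p
      = N Y W (F p)" if "Y \<in> sections B D" for Y
    unfolding nor_cov_along_def nor_cov_def cov_def push[OF that] ..
  \<comment> \<open>Agreement of \<open>FX\<close> with the pushed-forward \<open>X\<close> at the
    one point \<open>p\<close> is enough, since only the value of the direction at
    \<open>F p\<close> enters.\<close>
  have along: "nor_cov_along B gN D nabla F X (N V W) p = N FX (N V W) (F p)"
    unfolding nor_cov_along_def nor_cov_def cov_def assms(9) ..
  have "S V FX \<in> sections B D"
    using assms(8,10) shape_section unfolding sections_def by blast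
  then show ?thesis
    unfolding Let_def along adj[OF \<open>S V FX \<in> sections B D\<close>]
      adj[OF cov_in_D[OF assms(10,8)]]
    using curvature_decomposition[OF assms(8,10,11), of "F p"]
    by (simp add: algebra_simps)
qed

end
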